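(* Let $f\in C^\infty(\mathbb R^{N})$, $N=n+m$. With $Q,P,X,C,D,E,F,G$ and $\mathfrak R_{ab},\mathfrak R_{zb},\mathfrak R_\pi$ as defined in the context, suppose that there exist vectors $\Lambda_1,\Lambda_2\in\mathbb R^{N^2}$ (allowed to depend on the point $x$ and on $f$) such that $$(Q^{\mathsf T}Q\Lambda_1+P^{\mathsf T}P\Lambda_2)^{\mathsf T}X=(F+C+G+Q^{\mathsf T}D+P^{\mathsf T}E)^{\mathsf T}X .$$ Then $$\Gamma_2(f,f)+\Gamma_2^{z,\pi}(f,f)=\|\mathfrak{Hess}_{a,z}f\|^2+\mathfrak R(\nabla f,\nabla f),$$ where $$\|\mathfrak{Hess}_{a,z}f\|^2=[X+\Lambda_1]^{\mathsf T}Q^{\mathsf T}Q[X+\Lambda_1]+[X+\Lambda_2]^{\mathsf T}P^{\mathsf T}P[X+\Lambda_2],$$ $$\mathfrak R(\nabla f,\nabla f)=-\Lambda_1^{\mathsf T}Q^{\mathsf T}Q\Lambda_1-\Lambda_2^{\mathsf T}P^{\mathsf T}P\Lambda_2+D^{\mathsf T}D+E^{\mathsf T}E+\mathfrak R_{ab}(\nabla f,\nabla f)+\mathfrak R_{zb}(\nabla f,\nabla f)+\mathfrak R_{\pi}(\nabla f,\nabla f).$$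
   Context: Setting. $n,m\ge1$ integers, $N=n+m$. $a:\mathbb R^N\to\mathbb R^{N\times n}$ and $z:\mathbb R^N\to\mathbb R^{N\times m}$ are smooth matrix functions, $b:\mathbb R^N\to\mathbb R^N$ a smooth vector field, $\pi$ a smooth strictly positive probability density on $\mathbb R^N$, and $b=a\otimes\nabla a+aa^{\mathsf T}\nabla\log\pi$, where $(a\otimes\nabla a)_p=\sum_{k=1}^n\sum_{q=1}^{N}a_{pk}\,\partial_q a_{qk}$. The columns of $a$, viewed as vector fields, satisfy the strong H\"ormander (bracket generating) condition at every point. Operators. $Lf=\nabla\cdot(aa^{\mathsf T}\nabla f)-\langle a\otimes\nabla a,\nabla f\rangle+\langle b,\nabla f\rangle$. $\Gamma_1(f,g)=\langle a^{\mathsf T}\nabla f,a^{\mathsf T}\nabla g\rangle_{\mathbb R^n}$, $\Gamma_1^z(f,g)=\langle z^{\mathsf T}\nabla f,z^{\mathsf T}\nabla g\rangle_{\mathbb R^m}$, $\Gamma_2(f,g)=\frac12[L\Gamma_1(f,g)-\Gamma_1(Lf,g)-\Gamma_1(f,Lg)]$, and $$\Gamma_2^{z,\pi}(f,g)=\tfrac12[L\Gamma_1^z(f,g)-\Gamma_1^z(Lf,g)-\Gamma_1^z(f,Lg)]+\tfrac1\pi\nabla\cdot\big(\pi zz^{\mathsf T}\Gamma_{1,\nabla(aa^{\mathsf T})}(f,g)\big)-\tfrac1\pi\nabla\cdot\big(\pi aa^{\mathsf T}\Gamma_{1,\nabla(zz^{\mathsf T})}(f,g)\big),$$ where $\Gamma_{1,\nabla(aa^{\mathsf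 T})}(f,g)$ is the vector with components $\langle\nabla f,\partial_p(aa^{\mathsf T})\nabla g\rangle$, $p=1,\dots,N$, and $\Gamma_{1,\nabla(zz^{\mathsf T})}(f,g)$ the vector with components $\langle\nabla f,\partial_p(zz^{\mathsf T})\nabla g\rangle$. Notation. Put $\alpha_{ip}=a_{pi}=(a^{\mathsf T})_{ip}$ and $\zeta_{kp}=z_{pk}=(z^{\mathsf T})_{kp}$. Indices $p,q,r,s$ run over $1,\dots,N$; each derivative acts only on the single factor immediately following it (inside the parentheses). $(a^{\mathsf T}\nabla f)_k=\sum_p\alpha_{kp}\partial_pf$, $(z^{\mathsf T}\nabla f)_k=\sum_p\zeta_{kp}\partial_pf$. $Q\in\mathbb R^{n^2\times N^2}$: $Q_{(i,k),(p,q)}=\alpha_{ip}\alpha_{kq}$ $(1\le i,k\le n)$. $P\in\mathbb R^{nm\times N^2}$: $P_{(i,k),(p,q)}=\alpha_{ip}\zeta_{kq}$ $(1\le i\le n,1\le k\le m)$. $X\in\mathbb R^{N^2}$: $X_{(p,q)}=\partial_p\partial_qf$. Vectors $C,F,G\in\mathbb R^{N^2}$, $D\in\mathbb R^{n^2}$, $E\in\mathbb R^{nm}$: $$C_{pq}=\sum_{i,k=1}^n\sum_r\big(\alpha_{ip}\alpha_{ir}(\partial_r\alpha_{kq})-\alpha_{kr}\alpha_{iq}(\partial_r\alpha_{ip})\big)(a^{\mathsf T}\nabla f)_k,\qquad D_{ik}=\sum_{p,q}\alpha_{ip}(\partial_p\alpha_{kq})\partial_qf,$$ $$F_{pq}=\sum_{i=1}^n\sum_{k=1}^m\sum_r\big(\alpha_{ip}\alpha_{ir}(\partial_r\zeta_{kq})-\zeta_{kr}\alpha_{iq}(\partial_r\alpha_{ip})\big)(z^{\mathsf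 T}\nabla f)_k,\qquad E_{ik}=\sum_{p,q}\alpha_{ip}(\partial_p\zeta_{kq})\partial_qf,$$ $$G_{pq}=\sum_{i=1}^n\sum_{j=1}^m\sum_{r,s}\Big[\zeta_{jq}\zeta_{js}(\partial_s\alpha_{ip})\alpha_{ir}\partial_rf+\zeta_{jq}\zeta_{js}(\partial_s\alpha_{ir})(\partial_rf)\alpha_{ip}-\alpha_{ip}\alpha_{ir}(\partial_r\zeta_{jq})\zeta_{js}\partial_sf-\alpha_{ip}\alpha_{ir}(\partial_r\zeta_{js})(\partial_sf)\zeta_{jq}\Big].$$ Quadratic forms in $\nabla f$: $$\mathfrak R_a=\sum_{i,k=1}^n\sum_{p,q,r}\big[\alpha_{ir}(\partial_r\alpha_{ip})(\partial_p\alpha_{kq})\partial_qf+\alpha_{ir}\alpha_{ip}(\partial_r\partial_p\alpha_{kq})\partial_qf-\alpha_{kq}(\partial_q\alpha_{ir})(\partial_r\alpha_{ip})\partial_pf-\alpha_{kq}\alpha_{ir}(\partial_q\partial_r\alpha_{ip})\partial_pf\big](a^{\mathsf T}\nabla f)_k,$$ $$\mathfrak R_{ab}=\mathfrak R_a-\sum_{i=1}^n\sum_{p,q}\big(\alpha_{ip}(\partial_pb_q)\partial_qf-b_q(\partial_q\alpha_{ip})\partial_pf\big)(a^{\mathsf T}\nabla f)_i,$$ $$\mathfrak R_z=\sum_{i=1}^n\sum_{k=1}^m\sum_{p,q,r}\big[\alpha_{ir}(\partial_r\alpha_{ip})(\partial_p\zeta_{kq})\partial_qf+\alpha_{ir}\alpha_{ip}(\partial_r\partial_p\zeta_{kq})\partial_qf-\zeta_{kq}(\partial_q\alpha_{ir})(\partial_r\alpha_{ip})\partial_pf-\zeta_{kq}\alpha_{ir}(\partial_q\partial_r\alpha_{ip})\partial_pf\big](z^{\mathsf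 T}\nabla f)_k,$$ $$\mathfrak R_{zb}=\mathfrak R_z-\sum_{i=1}^m\sum_{p,q}\big(\zeta_{ip}(\partial_pb_q)\partial_qf-b_q(\partial_q\zeta_{ip})\partial_pf\big)(z^{\mathsf T}\nabla f)_i,$$ $$\begin{aligned}\mathfrak R_\pi=\;&2\sum_{k=1}^m\sum_{i=1}^n\sum_{p,q,r,s}\big[(\partial_r\zeta_{kr})\zeta_{kq}(\partial_q\alpha_{ip})\alpha_{is}+\zeta_{kr}(\partial_r\zeta_{kq})(\partial_q\alpha_{ip})\alpha_{is}+\zeta_{kr}\zeta_{kq}(\partial_r\partial_q\alpha_{ip})\alpha_{is}+\zeta_{kr}\zeta_{kq}(\partial_q\alpha_{ip})(\partial_r\alpha_{is})\big]\partial_pf\,\partial_sf\\&+2\sum_{k=1}^m\sum_{i=1}^n\sum_{p,q,s}(z^{\mathsf T}\nabla\log\pi)_k\,\zeta_{kq}(\partial_q\alpha_{ip})\alpha_{is}\,\partial_pf\,\partial_sf\\&-2\sum_{j=1}^m\sum_{l=1}^n\sum_{p,q,r,s}\big[(\partial_r\alpha_{lr})\alpha_{lq}(\partial_q\zeta_{jp})\zeta_{js}+\alpha_{lr}(\partial_r\alpha_{lq})(\partial_q\zeta_{jp})\zeta_{js}+\alpha_{lr}\alpha_{lq}(\partial_r\partial_q\zeta_{jp})\zeta_{js}+\alpha_{lr}\alpha_{lq}(\partial_q\zeta_{jp})(\partial_r\zeta_{js})\big]\partial_pf\,\partial_sf\\&-2\sum_{j=1}^m\sum_{l=1}^n\sum_{p,q,s}(a^{\mathsf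 T}\nabla\log\pi)_l\,\alpha_{lq}(\partial_q\zeta_{jp})\zeta_{js}\,\partial_pf\,\partial_sf.\end{aligned}$$ *)

theory Defs
  imports "HOL-Analysis.Analysis"
begin

section \<open>Smoothness, derivatives and vector fields\<close>

text \<open>Class \<open>C\<^sup>k\<close> on the whole space: continuity for \<open>k = 0\<close>; otherwise differentiability
  everywhere, with all directional derivatives of class \<open>C\<^sup>k\<^sup>-\<^sup>1\<close>.\<close>

primrec C_k :: "nat \<Rightarrow> ('a::euclidean_space \<Rightarrow> 'b::real_normed_vector) \<Rightarrow> bool" where
  "C_k 0 f \<longleftrightarrow> continuous_on UNIV f"
| "C_k (Suc k) f \<longleftrightarrow> (\<forall>x. f differentiable (at x)) \<and>
     (\<forall>v. C_k k (\<lambda>x. frechet_derivative f (at x) v))"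

definition smooth :: "('a::euclidean_space \<Rightarrow> 'b::real_normed_vector) \<Rightarrow> bool" where
  "smooth f \<longleftrightarrow> (\<forall>k. C_k k f)"

definition pd :: "'N::finite \<Rightarrow> (real^'N \<Rightarrow> 'b::real_normed_vector) \<Rightarrow> real^'N \<Rightarrow> 'b" where
  "pd p f x = frechet_derivative f (at x) (axis p 1)"

definition grad :: "(real^'N::finite \<Rightarrow> real) \<Rightarrow> real^'N \<Rightarrow> real^'N" where
  "grad f x = (\<chi> p. pd p f x)"

definition divergence :: "(real^'N::finite \<Rightarrow> real^'N) \<Rightarrow> real^'N \<Rightarrow> real" where
  "divergence V x = (\<Sum>p\<in>UNIV. pd p (\<lambda>y. V y $ p) x)"

definition lie_bracket ::
    "(real^'N::finite \<Rightarrow> real^'N) \<Rightarrow> (real^'N \<Rightarrow> real^'N) \<Rightarrow> real^'N \<Rightarrow> real^'N" where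
  "lie_bracket V W x = frechet_derivative W (at x) (V x) - frechet_derivative V (at x) (W x)"

inductive_set iterated_brackets ::
    "(real^'N::finite \<Rightarrow> real^'N) set \<Rightarrow> (real^'N \<Rightarrow> real^'N) set"
  for S where
  base: "V \<in> S \<Longrightarrow> V \<in> iterated_brackets S"
| bracket: "\<lbrakk>V \<in> iterated_brackets S; W \<in> iterated_brackets S\<rbrakk>
    \<Longrightarrow> lie_bracket V W \<in> iterated_brackets S"

definition bracket_generating :: "(real^'N::finite \<Rightarrow> real^'n::finite^'N) \<Rightarrow> bool" where
  "bracket_generating a \<longleftrightarrow>
     (\<forall>x. span {V x | V. V \<in> iterated_brackets (range (\<lambda>i y. column i (a y)))} = UNIV)"

definition probability_density :: "(real^'N::finite \<Rightarrow> real) \<Rightarrow> bool" where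
  "probability_density \<pi> \<longleftrightarrow> (\<forall>x. 0 \<le> \<pi> x) \<and> has_bochner_integral lborel \<pi> 1"


section \<open>Operators\<close>

definition sq_mat :: "(real^'N::finite \<Rightarrow> real^'k::finite^'N) \<Rightarrow> real^'N \<Rightarrow> real^'N^'N" where
  "sq_mat c x = c x ** transpose (c x)"

text \<open>\<open>c\<^sup>T \<nabla>f\<close>\<close>

definition hgrad :: "(real^'N::finite \<Rightarrow> real^'k::finite^'N) \<Rightarrow> (real^'N \<Rightarrow> real) \<Rightarrow> real^'N \<Rightarrow> real^'k" where
  "hgrad c f x = transpose (c x) *v grad f x"

text \<open>\<open>a \<otimes> \<nabla>a\<close>\<close>

definition otimes_nabla :: "(real^'N::finite \<Rightarrow> real^'n::finite^'N) \<Rightarrow> real^'N \<Rightarrow> real^'N" where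
  "otimes_nabla a x =
     (\<chi> p. \<Sum>k\<in>UNIV. \<Sum>q\<in>UNIV. a x $ p $ k * pd q (\<lambda>y. a y $ q $ k) x)"

definition L :: "(real^'N::finite \<Rightarrow> real^'n::finite^'N) \<Rightarrow> (real^'N \<Rightarrow> real^'N)
    \<Rightarrow> (real^'N \<Rightarrow> real) \<Rightarrow> real^'N \<Rightarrow> real" where
  "L a b f x = divergence (\<lambda>y. sq_mat a y *v grad f y) x
     - otimes_nabla a x \<bullet> grad f x + b x \<bullet> grad f x"

text \<open>\<open>\<Gamma>\<^sub>1\<close> is \<open>Gamma1 a\<close> and \<open>\<Gamma>\<^sub>1\<^sup>z\<close> is \<open>Gamma1 z\<close>.\<close>

definition Gamma1 :: "(real^'N::finite \<Rightarrow> real^'k::finite^'N)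
    \<Rightarrow> (real^'N \<Rightarrow> real) \<Rightarrow> (real^'N \<Rightarrow> real) \<Rightarrow> real^'N \<Rightarrow> real" where
  "Gamma1 c f g x = hgrad c f x \<bullet> hgrad c g x"

text \<open>\<open>\<Gamma>\<^bsub>1,\<nabla>(cc\<^sup>T)\<^esub>(f,g)\<close>\<close>

definition Gamma1_nabla :: "(real^'N::finite \<Rightarrow> real^'k::finite^'N)
    \<Rightarrow> (real^'N \<Rightarrow> real) \<Rightarrow> (real^'N \<Rightarrow> real) \<Rightarrow> real^'N \<Rightarrow> real^'N" where
  "Gamma1_nabla c f g x = (\<chi> p. grad f x \<bullet> (pd p (sq_mat c) x *v grad g x))"

definition Gamma2 :: "(real^'N::finite \<Rightarrow> real^'n::finite^'N) \<Rightarrow> (real^'N \<Rightarrow> real^'N)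
    \<Rightarrow> (real^'N \<Rightarrow> real) \<Rightarrow> (real^'N \<Rightarrow> real) \<Rightarrow> real^'N \<Rightarrow> real" where
  "Gamma2 a b f g x = 1/2 * (L a b (Gamma1 a f g) x
     - Gamma1 a (L a b f) g x - Gamma1 a f (L a b g) x)"

definition Gamma2_z_pi :: "(real^'N::finite \<Rightarrow> real^'n::finite^'N) \<Rightarrow> (real^'N \<Rightarrow> real^'m::finite^'N)
    \<Rightarrow> (real^'N \<Rightarrow> real^'N) \<Rightarrow> (real^'N \<Rightarrow> real)
    \<Rightarrow> (real^'N \<Rightarrow> real) \<Rightarrow> (real^'N \<Rightarrow> real) \<Rightarrow> real^'N \<Rightarrow> real" where
  "Gamma2_z_pi a z b \<pi> f g x =
     1/2 * (L a b (Gamma1 z f g) x - Gamma1 z (L a b f) g x - Gamma1 z f (L a b g) x)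
     + 1 / \<pi> x * divergence (\<lambda>y. \<pi> y *\<^sub>R (sq_mat z y *v Gamma1_nabla a f g y)) x
     - 1 / \<pi> x * divergence (\<lambda>y. \<pi> y *\<^sub>R (sq_mat a y *v Gamma1_nabla z f g y)) x"


section \<open>Coefficient matrices and vectors\<close>

text \<open>\<open>tr a i p\<close> is the function \<open>\<alpha>\<^sub>i\<^sub>p = (a\<^sup>T)\<^sub>i\<^sub>p\<close> and \<open>tr z k p\<close> is \<open>\<zeta>\<^sub>k\<^sub>p = (z\<^sup>T)\<^sub>k\<^sub>p\<close>.\<close>

definition tr :: "(real^'N::finite \<Rightarrow> real^'k::finite^'N) \<Rightarrow> 'k \<Rightarrow> 'N \<Rightarrow> real^'N \<Rightarrow> real" where
  "tr c i p x = c x $ p $ i"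

text \<open>The objects \<open>P, E, F, \<RR>\<^sub>z, \<RR>\<^bsub>zb\<^esub>\<close> attached to \<open>(a, z)\<close> become
  \<open>Q, D, C, \<RR>\<^sub>a, \<RR>\<^bsub>ab\<^esub>\<close> when \<open>\<zeta>\<close> is replaced by \<open>\<alpha>\<close>
  (and \<open>m\<close> by \<open>n\<close>); each pair is therefore given by one formula in \<open>(a, c)\<close>,
  to be used with \<open>c = z\<close> and \<open>c = a\<close>.\<close>

definition QP :: "(real^'N::finite \<Rightarrow> real^'n::finite^'N) \<Rightarrow> (real^'N \<Rightarrow> real^'k::finite^'N)
    \<Rightarrow> real^'N \<Rightarrow> real^('N \<times> 'N)^('n \<times> 'k)" where
  "QP a c x = vec_lambda (\<lambda>(i, k). vec_lambda (\<lambda>(p, q). tr a i p x * tr c k q x))"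

definition X :: "(real^'N::finite \<Rightarrow> real) \<Rightarrow> real^'N \<Rightarrow> real^('N \<times> 'N)" where
  "X f x = vec_lambda (\<lambda>(p, q). pd p (pd q f) x)"

definition CF :: "(real^'N::finite \<Rightarrow> real^'n::finite^'N) \<Rightarrow> (real^'N \<Rightarrow> real^'k::finite^'N)
    \<Rightarrow> (real^'N \<Rightarrow> real) \<Rightarrow> real^'N \<Rightarrow> real^('N \<times> 'N)" where
  "CF a c f x = vec_lambda (\<lambda>(p, q). \<Sum>i\<in>UNIV. \<Sum>k\<in>UNIV. \<Sum>r\<in>UNIV.
     (tr a i p x * tr a i r x * pd r (tr c k q) x
      - tr c k r x * tr a i q x * pd r (tr a i p) x) * hgrad c f x $ k)"

definition DE :: "(real^'N::finite \<Rightarrow> real^'n::finite^'N) \<Rightarrow> (real^'N \<Rightarrow> real^'k::finite^'N)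
    \<Rightarrow> (real^'N \<Rightarrow> real) \<Rightarrow> real^'N \<Rightarrow> real^('n \<times> 'k)" where
  "DE a c f x = vec_lambda (\<lambda>(i, k). \<Sum>p\<in>UNIV. \<Sum>q\<in>UNIV.
     tr a i p x * pd p (tr c k q) x * pd q f x)"

definition G :: "(real^'N::finite \<Rightarrow> real^'n::finite^'N) \<Rightarrow> (real^'N \<Rightarrow> real^'m::finite^'N)
    \<Rightarrow> (real^'N \<Rightarrow> real) \<Rightarrow> real^'N \<Rightarrow> real^('N \<times> 'N)" where
  "G a z f x = vec_lambda (\<lambda>(p, q). \<Sum>i\<in>UNIV. \<Sum>j\<in>UNIV. \<Sum>r\<in>UNIV. \<Sum>s\<in>UNIV.
       tr z j q x * tr z j s x * pd s (tr a i p) x * tr a i r x * pd r f x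
     + tr z j q x * tr z j s x * pd s (tr a i r) x * pd r f x * tr a i p x
     - tr a i p x * tr a i r x * pd r (tr z j q) x * tr z j s x * pd s f x
     - tr a i p x * tr a i r x * pd r (tr z j s) x * pd s f x * tr z j q x)"


section \<open>Curvature forms\<close>

definition R0 :: "(real^'N::finite \<Rightarrow> real^'n::finite^'N) \<Rightarrow> (real^'N \<Rightarrow> real^'k::finite^'N)
    \<Rightarrow> (real^'N \<Rightarrow> real) \<Rightarrow> real^'N \<Rightarrow> real" where
  "R0 a c f x = (\<Sum>i\<in>UNIV. \<Sum>k\<in>UNIV. \<Sum>p\<in>UNIV. \<Sum>q\<in>UNIV. \<Sum>r\<in>UNIV.
     (tr a i r x * pd r (tr a i p) x * pd p (tr c k q) x * pd q f x
      + tr a i r x * tr a i p x * pd r (pd p (tr c k q)) x * pd q f x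
      - tr c k q x * pd q (tr a i r) x * pd r (tr a i p) x * pd p f x
      - tr c k q x * tr a i r x * pd q (pd r (tr a i p)) x * pd p f x) * hgrad c f x $ k)"

definition Rb :: "(real^'N::finite \<Rightarrow> real^'n::finite^'N) \<Rightarrow> (real^'N \<Rightarrow> real^'k::finite^'N)
    \<Rightarrow> (real^'N \<Rightarrow> real^'N) \<Rightarrow> (real^'N \<Rightarrow> real) \<Rightarrow> real^'N \<Rightarrow> real" where
  "Rb a c b f x = R0 a c f x
     - (\<Sum>i\<in>UNIV. \<Sum>p\<in>UNIV. \<Sum>q\<in>UNIV.
         (tr c i p x * pd p (\<lambda>y. b y $ q) x * pd q f x
          - b x $ q * pd q (tr c i p) x * pd p f x) * hgrad c f x $ i)"

text \<open>The positive half of \<open>\<RR>\<^sub>\<pi>\<close> is \<open>Rpi_half z a\<close>; the negative half is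
  obtained from it by exchanging the roles of \<open>\<zeta>\<close> and \<open>\<alpha>\<close>.\<close>

definition Rpi_half :: "(real^'N::finite \<Rightarrow> real^'k::finite^'N) \<Rightarrow> (real^'N \<Rightarrow> real^'l::finite^'N)
    \<Rightarrow> (real^'N \<Rightarrow> real) \<Rightarrow> (real^'N \<Rightarrow> real) \<Rightarrow> real^'N \<Rightarrow> real" where
  "Rpi_half c d \<pi> f x =
     2 * (\<Sum>k\<in>UNIV. \<Sum>i\<in>UNIV. \<Sum>p\<in>UNIV. \<Sum>q\<in>UNIV. \<Sum>r\<in>UNIV. \<Sum>s\<in>UNIV.
       (pd r (tr c k r) x * tr c k q x * pd q (tr d i p) x * tr d i s x
        + tr c k r x * pd r (tr c k q) x * pd q (tr d i p) x * tr d i s x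
        + tr c k r x * tr c k q x * pd r (pd q (tr d i p)) x * tr d i s x
        + tr c k r x * tr c k q x * pd q (tr d i p) x * pd r (tr d i s) x) * pd p f x * pd s f x)
     + 2 * (\<Sum>k\<in>UNIV. \<Sum>i\<in>UNIV. \<Sum>p\<in>UNIV. \<Sum>q\<in>UNIV. \<Sum>s\<in>UNIV.
       hgrad c (\<lambda>y. ln (\<pi> y)) x $ k * tr c k q x * pd q (tr d i p) x * tr d i s x
         * pd p f x * pd s f x)"

definition Rpi :: "(real^'N::finite \<Rightarrow> real^'n::finite^'N) \<Rightarrow> (real^'N \<Rightarrow> real^'m::finite^'N)
    \<Rightarrow> (real^'N \<Rightarrow> real) \<Rightarrow> (real^'N \<Rightarrow> real) \<Rightarrow> real^'N \<Rightarrow> real" where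
  "Rpi a z \<pi> f x = Rpi_half z a \<pi> f x - Rpi_half a z \<pi> f x"

text \<open>\<open>\<parallel>Hess\<^bsub>a,z\<^esub> f\<parallel>\<^sup>2\<close> and \<open>\<RR>(\<nabla>f, \<nabla>f)\<close> at \<open>x\<close>, for given
  values \<open>\<Lambda>1, \<Lambda>2\<close> of the correction vectors.\<close>

definition Hess_norm_sq :: "(real^'N::finite \<Rightarrow> real^'n::finite^'N) \<Rightarrow> (real^'N \<Rightarrow> real^'m::finite^'N)
    \<Rightarrow> (real^'N \<Rightarrow> real) \<Rightarrow> real^('N \<times> 'N) \<Rightarrow> real^('N \<times> 'N) \<Rightarrow> real^'N \<Rightarrow> real" where
  "Hess_norm_sq a z f \<Lambda>1 \<Lambda>2 x =
     (X f x + \<Lambda>1) \<bullet> ((transpose (QP a a x) ** QP a a x) *v (X f x + \<Lambda>1))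
   + (X f x + \<Lambda>2) \<bullet> ((transpose (QP a z x) ** QP a z x) *v (X f x + \<Lambda>2))"

definition R_form :: "(real^'N::finite \<Rightarrow> real^'n::finite^'N) \<Rightarrow> (real^'N \<Rightarrow> real^'m::finite^'N)
    \<Rightarrow> (real^'N \<Rightarrow> real^'N) \<Rightarrow> (real^'N \<Rightarrow> real)
    \<Rightarrow> (real^'N \<Rightarrow> real) \<Rightarrow> real^('N \<times> 'N) \<Rightarrow> real^('N \<times> 'N) \<Rightarrow> real^'N \<Rightarrow> real" where
  "R_form a z b \<pi> f \<Lambda>1 \<Lambda>2 x =
     - (\<Lambda>1 \<bullet> ((transpose (QP a a x) ** QP a a x) *v \<Lambda>1))
     - \<Lambda>2 \<bullet> ((transpose (QP a z x) ** QP a z x) *v \<Lambda>2)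
     + DE a a f x \<bullet> DE a a f x + DE a z f x \<bullet> DE a z f x
     + Rb a a b f x + Rb a z b f x + Rpi a z \<pi> f x"

end

theory Submission
  imports Defs
begin

text \<open>Write \<open>V\<^sub>i\<close> and \<open>Z\<^sub>k\<close> for the derivations given by the columns of \<open>a\<close> and \<open>z\<close>. The operator
  \<open>L\<close> equals \<open>\<Sum>\<^sub>i V\<^sub>i\<^sup>2 + b\<close>, so each carre du champ satisfies a Bochner identity: for \<open>C\<^sub>k\<close> either
  family, the iterated form is \<open>\<Sum> (V\<^sub>i C\<^sub>k f)\<^sup>2 + \<Sum> C\<^sub>k f [L, C\<^sub>k] f\<close>. Here \<open>V\<^sub>i C\<^sub>k f\<close> is the
  \<open>(i, k)\<close> entry of \<open>Q X + D\<close> or \<open>P X + E\<close>; in the commutators the third derivatives of \<open>f\<close> cancel,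
  the second ones give \<open>2 C \<cdot> X\<close> or \<open>2 F \<cdot> X\<close> and the first ones the curvature forms. The two weighted
  divergences contribute \<open>\<RR>\<^sub>\<pi> + 2 G \<cdot> X\<close>, and the hypothesis on \<open>\<Lambda>\<^sub>1, \<Lambda>\<^sub>2\<close> completes the squares.\<close>


section \<open>Calculus of smooth functions\<close>

lemma C_k_Suc_imp: "C_k (Suc k) f \<Longrightarrow> C_k k f"
proof (induction k arbitrary: f)
  case 0
  then show ?case
    by (simp add: continuous_at_imp_continuous_on differentiable_imp_continuous_within)
next
  case (Suc k)
  then show ?case by (metis C_k.simps(2))
qed

lemma C_k_bounded_linear:
  assumes "bounded_linear h"
  shows "C_k k f \<Longrightarrow> C_k k (\<lambda>x. h (f x))"
proof (induction k arbitrary: f)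
  case 0
  then show ?case
    using assms by (simp add: bounded_linear.continuous_on)
next
  case (Suc k)
  then have d: "((\<lambda>x. h (f x)) has_derivative (\<lambda>v. h (frechet_derivative f (at x) v))) (at x)" for x
    by (intro bounded_linear.has_derivative[OF assms]) (simp add: frechet_derivative_works[symmetric])
  have "frechet_derivative (\<lambda>x. h (f x)) (at x) = (\<lambda>v. h (frechet_derivative f (at x) v))" for x
    by (rule frechet_derivative_at[OF d, symmetric])
  then show ?case
    using differentiableI[OF d] Suc by simp
qed

lemma C_k_const: "C_k k (\<lambda>x. c)"
  by (induction k arbitrary: c) auto

lemma C_k_add: "C_k k f \<Longrightarrow> C_k k g \<Longrightarrow> C_k k (\<lambda>x. f x + g x)"
proof (induction k arbitrary: f g)
  case 0
  then show ?case by (simp add: continuous_on_add)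
next
  case (Suc k)
  then have d: "((\<lambda>x. f x + g x) has_derivative
      (\<lambda>v. frechet_derivative f (at x) v + frechet_derivative g (at x) v)) (at x)" for x
    by (intro has_derivative_add) (simp_all add: frechet_derivative_works[symmetric])
  have "frechet_derivative (\<lambda>x. f x + g x) (at x) =
      (\<lambda>v. frechet_derivative f (at x) v + frechet_derivative g (at x) v)" for x
    by (rule frechet_derivative_at[OF d, symmetric])
  then show ?case
    using differentiableI[OF d] Suc by simp
qed

lemma C_k_mult:
  fixes f g :: "'a::euclidean_space \<Rightarrow> real"
  shows "C_k k f \<Longrightarrow> C_k k g \<Longrightarrow> C_k k (\<lambda>x. f x * g x)"
proof (induction k arbitrary: f g)
  case 0
  then show ?case by (simp add: continuous_on_mult)
next
  case (Suc k)
  then have d: "((\<lambda>x. f x * g x) has_derivative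
      (\<lambda>v. f x * frechet_derivative g (at x) v + frechet_derivative f (at x) v * g x)) (at x)" for x
    by (intro has_derivative_mult) (simp_all add: frechet_derivative_works[symmetric])
  have "frechet_derivative (\<lambda>x. f x * g x) (at x) =
      (\<lambda>v. f x * frechet_derivative g (at x) v + frechet_derivative f (at x) v * g x)" for x
    by (rule frechet_derivative_at[OF d, symmetric])
  \<comment> \<open>The product rule leaves one factor of each summand undifferentiated, and the
    induction hypothesis needs that factor one class lower.\<close>
  moreover have "C_k k f" "C_k k g"
    using Suc.prems C_k_Suc_imp by blast+
  ultimately show ?case
    using differentiableI[OF d] Suc by (simp add: C_k_add)
qed

lemma smooth_differentiable: "smooth f \<Longrightarrow> f differentiable (at x)"
  unfolding smooth_def by (metis C_k.simps(2))

lemma smooth_frechet_derivative: "smooth f \<Longrightarrow> smooth (\<lambda>x. frechet_derivative f (at x) v)"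
  unfolding smooth_def by (metis C_k.simps(2))

lemma smooth_pd: "smooth f \<Longrightarrow> smooth (pd p f)"
  using smooth_frechet_derivative[of f "axis p 1"] by (simp add: pd_def[abs_def])

lemma smooth_continuous_at: "smooth f \<Longrightarrow> isCont f x"
  by (simp add: differentiable_imp_continuous_within smooth_differentiable)

lemma smooth_const: "smooth (\<lambda>x. c)"
  by (simp add: smooth_def C_k_const)

lemma smooth_add: "smooth f \<Longrightarrow> smooth g \<Longrightarrow> smooth (\<lambda>x. f x + g x)"
  by (simp add: smooth_def C_k_add)

lemma smooth_mult:
  fixes f g :: "'a::euclidean_space \<Rightarrow> real"
  shows "smooth f \<Longrightarrow> smooth g \<Longrightarrow> smooth (\<lambda>x. f x * g x)"
  by (simp add: smooth_def C_k_mult)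

lemma smooth_bounded_linear: "bounded_linear h \<Longrightarrow> smooth f \<Longrightarrow> smooth (\<lambda>x. h (f x))"
  by (simp add: smooth_def C_k_bounded_linear)

lemma smooth_sum: "(\<And>i. i \<in> I \<Longrightarrow> smooth (f i)) \<Longrightarrow> smooth (\<lambda>x. \<Sum>i\<in>I. f i x)"
  by (induction I rule: infinite_finite_induct) (auto simp: smooth_const smooth_add)

lemma smooth_nth: "smooth V \<Longrightarrow> smooth (\<lambda>x. V x $ p)"
  by (rule smooth_bounded_linear[OF bounded_linear_vec_nth])

text \<open>\<open>V\<close> is the finite sum of its components pushed through the bounded linear
  embeddings \<open>axis p\<close>, so closure under linear maps and sums suffices. The matrix
  function \<open>sq_mat d\<close> is handled this way.\<close>

lemma smooth_componentwise:
  fixes V :: "'a::euclidean_space \<Rightarrow> 'b::euclidean_space^'k"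
  assumes "\<And>p. smooth (\<lambda>x. V x $ p)"
  shows "smooth V"
proof -
  have "V = (\<lambda>x. \<Sum>p\<in>UNIV. axis p (V x $ p))"
    by (simp add: vec_eq_iff fun_eq_iff axis_def)
  moreover have "bounded_linear (axis p :: 'b \<Rightarrow> 'b^'k)" for p
    by (simp add: linear_conv_bounded_linear[symmetric]) (rule linearI; simp add: vec_eq_iff axis_def)
  ultimately show ?thesis
    using smooth_sum[of UNIV "\<lambda>p x. axis p (V x $ p)"] smooth_bounded_linear assms by metis
qed

lemma smooth_tr: "smooth c \<Longrightarrow> smooth (tr c i p)"
  using smooth_nth[OF smooth_nth, of c] by (simp add: tr_def[abs_def])

lemmas smooth_intros = smooth_pd smooth_const smooth_add smooth_mult smooth_sum smooth_nth smooth_tr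

section \<open>Rules for partial derivatives\<close>

lemma has_derivative_imp_pd: "(f has_derivative D) (at x) \<Longrightarrow> pd p f x = D (axis p 1)"
  unfolding pd_def using frechet_derivative_at by metis

lemma smooth_has_derivative: "smooth f \<Longrightarrow> (f has_derivative frechet_derivative f (at x)) (at x)"
  using smooth_differentiable frechet_derivative_works by blast

lemma pd_add:
  "smooth f \<Longrightarrow> smooth g \<Longrightarrow> pd p (\<lambda>x. f x + g x) = (\<lambda>x. pd p f x + pd p g x)"
  by (rule ext, subst has_derivative_imp_pd[OF has_derivative_add])
    (auto intro: smooth_has_derivative simp: pd_def)

lemma pd_mult:
  fixes f g :: "real^'N \<Rightarrow> real"
  shows "smooth f \<Longrightarrow> smooth g \<Longrightarrow> pd p (\<lambda>x. f x * g x) = (\<lambda>x. pd p f x * g x + f x * pd p g x)"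
  by (rule ext, subst has_derivative_imp_pd[OF has_derivative_mult])
    (auto intro: smooth_has_derivative simp: pd_def)

lemma pd_const: "pd p (\<lambda>x. c) = (\<lambda>x. 0)"
  by (simp add: pd_def fun_eq_iff)

lemma pd_sum:
  "(\<And>i. i \<in> I \<Longrightarrow> smooth (f i)) \<Longrightarrow> pd p (\<lambda>x. \<Sum>i\<in>I. f i x) = (\<lambda>x. \<Sum>i\<in>I. pd p (f i) x)"
  by (induction I rule: infinite_finite_induct) (auto simp: pd_const pd_add smooth_sum)

lemma pd_bounded_linear:
  "bounded_linear h \<Longrightarrow> smooth f \<Longrightarrow> pd p (\<lambda>x. h (f x)) x = h (pd p f x)"
  by (subst has_derivative_imp_pd[OF bounded_linear.has_derivative])
    (auto intro: smooth_has_derivative simp: pd_def)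

lemma pd_ln:
  assumes "smooth \<rho>" and "\<rho> x > (0::real)"
  shows "pd p (\<lambda>y. ln (\<rho> y)) x = pd p \<rho> x / \<rho> x"
  by (subst has_derivative_imp_pd[OF has_derivative_ln])
    (use assms in \<open>auto intro: smooth_has_derivative simp: pd_def divide_inverse mult.commute\<close>)

section \<open>Symmetry of second derivatives\<close>

lemma second_difference_mvt:
  fixes f :: "'a::euclidean_space \<Rightarrow> real"
  assumes "smooth f" and h: "h > 0"
  obtains s t where "0 < s" "s < h" "0 < t" "t < h"
    "f (x + h *\<^sub>R u + h *\<^sub>R v) - f (x + h *\<^sub>R u) - (f (x + h *\<^sub>R v) - f x) =
     h * (h * frechet_derivative (\<lambda>y. frechet_derivative f (at y) u) (at (x + s *\<^sub>R u + t *\<^sub>R v)) v)"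
proof -
  \<comment> \<open>Restriction to the line through \<open>y\<close> in direction \<open>w\<close>
    reduces the problem to one variable, where the mean value theorem applies.\<close>
  have line: "((\<lambda>s. g (y + s *\<^sub>R w)) has_real_derivative frechet_derivative g (at (y + s *\<^sub>R w)) w) (at s)"
    if g: "smooth g" for g :: "'a \<Rightarrow> real" and y w s
  proof -
    have "((\<lambda>s. y + s *\<^sub>R w) has_derivative (\<lambda>r. r *\<^sub>R w)) (at s)"
      by (auto intro!: derivative_eq_intros)
    from has_derivative_compose[OF this smooth_has_derivative[OF g]]
    have "((\<lambda>s. g (y + s *\<^sub>R w)) has_derivative
        (\<lambda>r. frechet_derivative g (at (y + s *\<^sub>R w)) (r *\<^sub>R w))) (at s)" .
    moreover have "frechet_derivative g (at (y + s *\<^sub>R w)) (r *\<^sub>R w) =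
        frechet_derivative g (at (y + s *\<^sub>R w)) w * r" for r
      using linear_frechet_derivative[OF smooth_differentiable[OF g]]
      by (simp add: linear_scale)
    ultimately show ?thesis by (simp add: has_field_derivative_def)
  qed
  let ?Du = "\<lambda>y. frechet_derivative f (at y) u"
  \<comment> \<open>The second difference is the increment over [0, h] of the difference of
    \<open>f\<close> along two parallel lines in direction \<open>u\<close>. The mean value theorem
    gives \<open>s\<close>; a second application, in direction \<open>v\<close> at this
    \<open>s\<close>, gives \<open>t\<close>.\<close>
  have "((\<lambda>s. f (x + h *\<^sub>R v + s *\<^sub>R u) - f (x + s *\<^sub>R u)) has_real_derivative
      ?Du (x + h *\<^sub>R v + s *\<^sub>R u) - ?Du (x + s *\<^sub>R u)) (at s)" for s
    by (intro DERIV_diff line assms)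
  from MVT2[OF h this] obtain s where s: "0 < s" "s < h" and
    1: "f (x + h *\<^sub>R v + h *\<^sub>R u) - f (x + h *\<^sub>R u) - (f (x + h *\<^sub>R v) - f x) =
      h * (?Du (x + h *\<^sub>R v + s *\<^sub>R u) - ?Du (x + s *\<^sub>R u))"
    by auto
  from MVT2[OF h line[OF smooth_frechet_derivative[OF \<open>smooth f\<close>, of u], of "x + s *\<^sub>R u" v]]
  obtain t where t: "0 < t" "t < h" and
    2: "?Du (x + s *\<^sub>R u + h *\<^sub>R v) - ?Du (x + s *\<^sub>R u) =
      h * frechet_derivative ?Du (at (x + s *\<^sub>R u + t *\<^sub>R v)) v"
    by auto
  show ?thesis
    by (rule that[OF s t]) (use 1 2 in \<open>simp add: algebra_simps\<close>)
qed

text \<open>Schwarz's theorem. The second difference is symmetric in \<open>u\<close> and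
  \<open>v\<close>, so h^2 times either mixed derivative, taken at suitable points near
  \<open>x\<close>, is the same number; continuity of both at \<open>x\<close> then rules out
  different values there.\<close>

lemma second_frechet_derivative_commute:
  fixes f :: "'a::euclidean_space \<Rightarrow> real"
  assumes "smooth f"
  shows "frechet_derivative (\<lambda>y. frechet_derivative f (at y) u) (at x) v =
    frechet_derivative (\<lambda>y. frechet_derivative f (at y) v) (at x) u" (is "?A x = ?B x")
proof (rule ccontr)
  assume neq: "?A x \<noteq> ?B x"
  \<comment> \<open>Half the gap: two errors below \<open>e\<close> cannot bridge it.\<close>
  define e where "e = \<bar>?A x - ?B x\<bar> / 2"
  have e: "e > 0" using neq by (simp add: e_def)
  have "isCont ?A x" "isCont ?B x"
    using assms by (intro smooth_continuous_at smooth_frechet_derivative; simp)+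
  then have "\<exists>d>0. \<forall>y. dist y x < d \<longrightarrow> dist (?A y) (?A x) < e"
    and "\<exists>d>0. \<forall>y. dist y x < d \<longrightarrow> dist (?B y) (?B x) < e"
    using e unfolding continuous_at_eps_delta by (simp_all add: dist_commute)
  then obtain d1 d2 where d1: "d1 > 0" "\<And>y. dist y x < d1 \<Longrightarrow> dist (?A y) (?A x) < e"
    and d2: "d2 > 0" "\<And>y. dist y x < d2 \<Longrightarrow> dist (?B y) (?B x) < e"
    by blast
  \<comment> \<open>With this step every point reached by the mean value theorem lies within both
    radii. The summand 1 keeps the denominator positive when \<open>u\<close> and \<open>v\<close>
    vanish and makes the estimate strict.\<close>
  define h where "h = min d1 d2 / (norm u + norm v + 1)"
  have nn: "norm u + norm v + 1 > 0" by (simp add: add_nonneg_pos)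
  have h: "h > 0" using d1 d2 nn by (simp add: h_def)
  have small: "dist (x + s *\<^sub>R u + t *\<^sub>R v) x < min d1 d2" if "0 < s" "s < h" "0 < t" "t < h" for s t
  proof -
    have "dist (x + s *\<^sub>R u + t *\<^sub>R v) x \<le> s * norm u + t * norm v"
      using norm_triangle_ineq[of "s *\<^sub>R u" "t *\<^sub>R v"] that by (simp add: dist_norm add.assoc)
    also have "\<dots> \<le> h * norm u + h * norm v"
      using that by (intro add_mono mult_right_mono) auto
    also have "\<dots> < h * (norm u + norm v + 1)" using h by (simp add: algebra_simps)
    also have "\<dots> = min d1 d2" using nn by (simp add: h_def)
    finally show ?thesis .
  qed
  obtain s t where st: "0 < s" "s < h" "0 < t" "t < h" and
    1: "f (x + h *\<^sub>R u + h *\<^sub>R v) - f (x + h *\<^sub>R u) - (f (x + h *\<^sub>R v) - f x) =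
      h * (h * ?A (x + s *\<^sub>R u + t *\<^sub>R v))"
    using second_difference_mvt[OF assms h] by metis
  obtain s' t' where st': "0 < s'" "s' < h" "0 < t'" "t' < h" and
    2: "f (x + h *\<^sub>R v + h *\<^sub>R u) - f (x + h *\<^sub>R v) - (f (x + h *\<^sub>R u) - f x) =
      h * (h * ?B (x + s' *\<^sub>R v + t' *\<^sub>R u))"
    using second_difference_mvt[OF assms h] by metis
  \<comment> \<open>Commuting the increments identifies the second difference for exchanged
    \<open>u\<close> and \<open>v\<close> with the original one.\<close>
  have "x + h *\<^sub>R v + h *\<^sub>R u = x + h *\<^sub>R u + h *\<^sub>R v" by simp
  then have "f (x + h *\<^sub>R u + h *\<^sub>R v) - f (x + h *\<^sub>R v) - (f (x + h *\<^sub>R u) - f x) =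
      h * (h * ?B (x + s' *\<^sub>R v + t' *\<^sub>R u))"
    using 2 by (simp only:)
  with 1 have "h * (h * ?A (x + s *\<^sub>R u + t *\<^sub>R v)) = h * (h * ?B (x + s' *\<^sub>R v + t' *\<^sub>R u))"
    by linarith
  then have "?A (x + s *\<^sub>R u + t *\<^sub>R v) = ?B (x + t' *\<^sub>R u + s' *\<^sub>R v)"
    using h by (simp add: add.commute add.left_commute)
  moreover have "\<bar>?A (x + s *\<^sub>R u + t *\<^sub>R v) - ?A x\<bar> < e"
    using d1(2) small[OF st] by (simp add: dist_real_def)
  moreover have "\<bar>?B (x + t' *\<^sub>R u + s' *\<^sub>R v) - ?B x\<bar> < e"
    using d2(2) small[OF st'(3,4,1,2)] by (simp add: dist_real_def)
  ultimately have "\<bar>?A x - ?B x\<bar> < 2 * e" by linarith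
  then show False by (simp add: e_def)
qed

lemma pd_commute:
  fixes f :: "real^'N \<Rightarrow> real"
  assumes "smooth f"
  shows "pd p (pd q f) = pd q (pd p f)"
  unfolding pd_def[abs_def] by (rule ext) (rule second_frechet_derivative_commute[OF assms])

section \<open>First-order operators\<close>

text \<open>The coefficients form a family of scalar functions, so that a column
  \<open>tr a i\<close> can be passed directly and the drift enters as
  \<open>\<lambda>p y. b y $ p\<close>.\<close>

definition vf :: "('N::finite \<Rightarrow> real^'N \<Rightarrow> real) \<Rightarrow> (real^'N \<Rightarrow> real) \<Rightarrow> real^'N \<Rightarrow> real" where
  "vf v f x = (\<Sum>p\<in>UNIV. v p x * pd p f x)"

lemma smooth_vf: "(\<And>p. smooth (v p)) \<Longrightarrow> smooth f \<Longrightarrow> smooth (vf v f)"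
  unfolding vf_def[abs_def] by (intro smooth_intros)

lemma vf_add: "smooth f \<Longrightarrow> smooth g \<Longrightarrow> vf v (\<lambda>x. f x + g x) = (\<lambda>x. vf v f x + vf v g x)"
  by (simp add: vf_def fun_eq_iff pd_add distrib_left sum.distrib)

lemma vf_mult:
  "smooth f \<Longrightarrow> smooth g \<Longrightarrow> vf v (\<lambda>x. f x * g x) = (\<lambda>x. vf v f x * g x + f x * vf v g x)"
  by (simp add: vf_def fun_eq_iff pd_mult algebra_simps sum.distrib sum_distrib_left)

lemma vf_const: "vf v (\<lambda>x. c) = (\<lambda>x. 0)"
  by (simp add: vf_def pd_const fun_eq_iff)

lemma vf_sum:
  "(\<And>i. i \<in> I \<Longrightarrow> smooth (f i)) \<Longrightarrow> vf v (\<lambda>x. \<Sum>i\<in>I. f i x) = (\<lambda>x. \<Sum>i\<in>I. vf v (f i) x)"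
  by (simp add: vf_def fun_eq_iff pd_sum sum_distrib_left) (simp add: sum.swap[of _ I])

lemma pd_vf:
  assumes "\<And>p. smooth (v p)" and "smooth f"
  shows "pd r (vf v f) = (\<lambda>x. \<Sum>p\<in>UNIV. pd r (v p) x * pd p f x + v p x * pd r (pd p f) x)"
  unfolding vf_def[abs_def] using assms by (simp add: pd_sum pd_mult smooth_intros)

lemma pd_pd_vf:
  assumes "\<And>p. smooth (v p)" and "smooth f"
  shows "pd s (pd r (vf v f)) x = (\<Sum>p\<in>UNIV. pd s (pd r (v p)) x * pd p f x + pd r (v p) x * pd s (pd p f) x
    + (pd s (v p) x * pd r (pd p f) x + v p x * pd s (pd r (pd p f)) x))"
  using assms by (simp add: pd_vf pd_sum pd_add pd_mult smooth_intros)

lemma vf_vf: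
  assumes "\<And>p. smooth (v p)" and "smooth f"
  shows "vf u (vf v f) x =
    (\<Sum>r\<in>UNIV. \<Sum>p\<in>UNIV. u r x * pd r (v p) x * pd p f x + u r x * v p x * pd r (pd p f) x)"
  unfolding vf_def[of u] using assms
  by (simp add: pd_vf sum_distrib_left distrib_left mult.assoc)

section \<open>The operators in terms of column derivations\<close>

lemma hgrad_nth: "hgrad c f x $ k = vf (tr c k) f x"
  by (simp add: hgrad_def vf_def tr_def grad_def matrix_vector_mult_def transpose_def)

lemma sq_mat_nth: "sq_mat c x $ p $ q = (\<Sum>k\<in>UNIV. tr c k p x * tr c k q x)"
  by (simp add: sq_mat_def matrix_matrix_mult_def transpose_def tr_def)

lemma sq_mat_mult_nth: "(sq_mat c x *v w) $ p = (\<Sum>k\<in>UNIV. tr c k p x * (\<Sum>q\<in>UNIV. tr c k q x * w $ q))"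
  by (simp add: matrix_vector_mult_def sq_mat_nth sum_distrib_left sum_distrib_right mult.assoc)
    (rule sum.swap)

lemma Gamma1_eq: "Gamma1 c f g x = (\<Sum>k\<in>UNIV. vf (tr c k) f x * vf (tr c k) g x)"
  by (simp add: Gamma1_def inner_vec_def hgrad_nth)

text \<open>Subtracting \<open>a \<otimes> \<nabla>a\<close> removes the divergences of the columns of \<open>a\<close>, which leaves a sum of
  squares plus drift.\<close>

lemma L_eq:
  fixes a :: "real^'N \<Rightarrow> real^'n^'N"
  assumes "smooth a" "smooth f"
  shows "L a b f x = (\<Sum>i\<in>UNIV. vf (tr a i) (vf (tr a i) f) x) + vf (\<lambda>p y. b y $ p) f x"
proof -
  let ?D = "\<lambda>i. \<Sum>p\<in>UNIV. pd p (tr a i p) x"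
  have "(sq_mat a y *v grad f y) $ p = (\<Sum>i\<in>UNIV. tr a i p y * vf (tr a i) f y)" for y p
    by (simp add: sq_mat_mult_nth vf_def grad_def)
  then have "divergence (\<lambda>y. sq_mat a y *v grad f y) x =
      (\<Sum>p\<in>UNIV. \<Sum>i\<in>UNIV. pd p (tr a i p) x * vf (tr a i) f x + tr a i p x * pd p (vf (tr a i) f) x)"
    using assms by (simp add: divergence_def pd_sum pd_mult smooth_intros smooth_vf)
  also have "\<dots> = (\<Sum>i\<in>UNIV. ?D i * vf (tr a i) f x) + (\<Sum>i\<in>UNIV. vf (tr a i) (vf (tr a i) f) x)"
    by (subst sum.swap) (simp add: sum.distrib sum_distrib_right vf_def[of _ "vf _ _"])
  finally have div: "divergence (\<lambda>y. sq_mat a y *v grad f y) x = \<dots>" .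
  have "otimes_nabla a x \<bullet> grad f x =
      (\<Sum>p\<in>UNIV. \<Sum>i\<in>UNIV. ?D i * (tr a i p x * pd p f x))"
    by (simp add: otimes_nabla_def grad_def inner_vec_def tr_def[abs_def] sum_distrib_left
        sum_distrib_right mult_ac)
  also have "\<dots> = (\<Sum>i\<in>UNIV. ?D i * vf (tr a i) f x)"
    by (subst sum.swap) (simp add: vf_def sum_distrib_left)
  finally show ?thesis
    using div by (simp add: L_def vf_def inner_vec_def grad_def)
qed

text \<open>Let W be a column derivation of \<open>c\<close> and u = W f. As \<open>L\<close> is a
  sum of squares plus drift, the product rule gives L(u^2) = 2 u L u + 2 sum_i (V_i u)^2.
  Subtracting 2 u W(L f) leaves the squares and the commutator of \<open>L\<close> with W, kept
  apart as its sum-of-squares part and its drift part.\<close>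

lemma bochner:
  fixes a :: "real^'N \<Rightarrow> real^'n^'N" and c :: "real^'N \<Rightarrow> real^'k^'N"
  assumes a: "smooth a" and b: "smooth b" and c: "smooth c" and f: "smooth f"
  shows "1/2 * (L a b (Gamma1 c f f) x - Gamma1 c (L a b f) f x - Gamma1 c f (L a b f) x) =
    (\<Sum>i\<in>UNIV. \<Sum>k\<in>UNIV. (vf (tr a i) (vf (tr c k) f) x)\<^sup>2)
    + (\<Sum>k\<in>UNIV. vf (tr c k) f x * (\<Sum>i\<in>UNIV. vf (tr a i) (vf (tr a i) (vf (tr c k) f)) x
         - vf (tr c k) (vf (tr a i) (vf (tr a i) f)) x))
    + (\<Sum>k\<in>UNIV. vf (tr c k) f x * (vf (\<lambda>p y. b y $ p) (vf (tr c k) f) x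
         - vf (tr c k) (vf (\<lambda>p y. b y $ p) f) x))"
proof -
  let ?b = "\<lambda>p y. b y $ p"
  define u where "u k = vf (tr c k) f" for k
  have sa: "smooth (tr a i p)" and sb: "smooth (?b p)" and sc: "smooth (tr c k p)" for i k p
    using a b c by (simp_all add: smooth_intros)
  have su: "smooth (u k)" for k
    by (simp add: u_def smooth_vf sc f)
  have G: "Gamma1 c f f = (\<lambda>y. \<Sum>k\<in>UNIV. u k y * u k y)"
    by (simp add: Gamma1_eq u_def fun_eq_iff)
  have sG: "smooth (Gamma1 c f f)"
    unfolding G by (intro smooth_intros su)
  have V: "vf (tr a i) (vf (tr a i) (Gamma1 c f f)) x =
      (\<Sum>k\<in>UNIV. 2 * (vf (tr a i) (u k) x)\<^sup>2 + 2 * (u k x * vf (tr a i) (vf (tr a i) (u k)) x))" for i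
    by (simp add: G vf_sum vf_mult vf_add vf_const smooth_intros smooth_vf su sa)
      (simp add: algebra_simps power2_eq_square)
  have B: "vf ?b (Gamma1 c f f) x = (\<Sum>k\<in>UNIV. 2 * (u k x * vf ?b (u k) x))"
    by (simp add: G vf_sum vf_mult smooth_intros su)
  have "L a b (Gamma1 c f f) x = 2 * (\<Sum>i\<in>UNIV. \<Sum>k\<in>UNIV. (vf (tr a i) (u k) x)\<^sup>2)
      + 2 * (\<Sum>k\<in>UNIV. \<Sum>i\<in>UNIV. u k x * vf (tr a i) (vf (tr a i) (u k)) x)
      + 2 * (\<Sum>k\<in>UNIV. u k x * vf ?b (u k) x)"
    by (subst sum.swap[of _ UNIV UNIV])
      (simp add: L_eq[OF a sG] V B sum.distrib sum_distrib_left)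
  moreover have Lf: "L a b f = (\<lambda>x. (\<Sum>i\<in>UNIV. vf (tr a i) (vf (tr a i) f) x) + vf ?b f x)"
    by (simp add: fun_eq_iff L_eq[OF a f])
  have "vf (tr c k) (L a b f) x =
      (\<Sum>i\<in>UNIV. vf (tr c k) (vf (tr a i) (vf (tr a i) f)) x) + vf (tr c k) (vf ?b f) x" for k
    by (simp add: Lf vf_add vf_sum smooth_intros smooth_vf sa sb f)
  then have "Gamma1 c f (L a b f) x = (\<Sum>k\<in>UNIV. u k x *
      ((\<Sum>i\<in>UNIV. vf (tr c k) (vf (tr a i) (vf (tr a i) f)) x) + vf (tr c k) (vf ?b f) x))"
    by (simp add: Gamma1_eq u_def)
  moreover have "Gamma1 c (L a b f) f x = Gamma1 c f (L a b f) x"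
    by (simp add: Gamma1_eq mult.commute)
  ultimately show ?thesis
    by (simp add: u_def[symmetric] algebra_simps sum.distrib sum_subtractf sum_distrib_left)
qed

section \<open>Commutators\<close>

text \<open>The second-order parts cancel by symmetry of the Hessian. Summands and outer sign are
  arranged to match the drift term of \<open>Rb\<close>, with \<open>v\<close> the drift and
  \<open>w\<close> a column of \<open>c\<close>.\<close>

lemma vf_commutator:
  fixes f :: "real^'N \<Rightarrow> real"
  assumes "\<And>p. smooth (v p)" "\<And>p. smooth (w p)" "smooth f"
  shows "vf v (vf w f) x - vf w (vf v f) x =
    - (\<Sum>p\<in>UNIV. \<Sum>q\<in>UNIV. w p x * pd p (v q) x * pd q f x - v q x * pd q (w p) x * pd p f x)"
proof -
  have comm: "pd p (pd q f) x = pd q (pd p f) x" for p q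
    by (simp add: pd_commute[OF assms(3), of p q])
  have "(\<Sum>q\<in>UNIV. \<Sum>p\<in>UNIV. v q x * (w p x * pd q (pd p f) x)) =
      (\<Sum>p\<in>UNIV. \<Sum>q\<in>UNIV. w p x * (v q x * pd p (pd q f) x))"
    by (subst sum.swap) (intro sum.cong refl, subst comm, simp add: mult_ac)
  moreover have "(\<Sum>q\<in>UNIV. \<Sum>p\<in>UNIV. v q x * (pd q (w p) x * pd p f x)) =
      (\<Sum>p\<in>UNIV. \<Sum>q\<in>UNIV. v q x * (pd q (w p) x * pd p f x))"
    by (rule sum.swap)
  ultimately show ?thesis
    using assms unfolding vf_def[of v "vf w f"] vf_def[of w "vf v f"]
    by (simp add: pd_vf sum_distrib_left distrib_left sum.distrib sum_subtractf mult.assoc)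
qed

lemma sum3_rotate: "(\<Sum>x\<in>A. \<Sum>y\<in>B. \<Sum>z\<in>C. f x y z) = (\<Sum>y\<in>B. \<Sum>z\<in>C. \<Sum>x\<in>A. f x y z)"
  by (subst sum.swap) (intro sum.cong refl sum.swap)

text \<open>Each triple composition expands into six terms. The third-order terms agree by symmetry;
  in second order one term is common to both sides and the others coincide in pairs, whence the
  factor 2. For \<open>v = tr a i\<close> and \<open>w = tr c k\<close> the two brackets are those
  of \<open>CF\<close> and \<open>R0\<close>.\<close>

lemma vf_square_commutator:
  fixes f :: "real^'N \<Rightarrow> real"
  assumes v: "\<And>p. smooth (v p)" and w: "\<And>p. smooth (w p)" and f: "smooth f"
  shows "vf v (vf v (vf w f)) x - vf w (vf v (vf v f)) x =
    2 * (\<Sum>p\<in>UNIV. \<Sum>q\<in>UNIV. \<Sum>r\<in>UNIV.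
      (v p x * v r x * pd r (w q) x - w r x * v q x * pd r (v p) x) * pd p (pd q f) x)
    + (\<Sum>p\<in>UNIV. \<Sum>q\<in>UNIV. \<Sum>r\<in>UNIV.
      v r x * pd r (v p) x * pd p (w q) x * pd q f x
      + v r x * v p x * pd r (pd p (w q)) x * pd q f x
      - w q x * pd q (v r) x * pd r (v p) x * pd p f x
      - w q x * v r x * pd q (pd r (v p)) x * pd p f x)"
proof -
  have comm: "pd p (pd q g) x = pd q (pd p g) x" if "smooth g" for p q and g :: "real^'N \<Rightarrow> real"
    by (simp add: pd_commute[OF that, of p q])
  have "vf v (vf v (vf w f)) x = (\<Sum>r\<in>UNIV. \<Sum>p\<in>UNIV. \<Sum>q\<in>UNIV.
      v r x * pd r (v p) x * pd p (w q) x * pd q f x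
      + v r x * pd r (v p) x * w q x * pd p (pd q f) x
      + v r x * v p x * pd r (pd p (w q)) x * pd q f x
      + v r x * v p x * pd p (w q) x * pd r (pd q f) x
      + v r x * v p x * pd r (w q) x * pd p (pd q f) x
      + v r x * v p x * w q x * pd r (pd p (pd q f)) x)"
    unfolding vf_vf[OF v smooth_vf[OF w f]]
    unfolding pd_pd_vf[OF w f]
    unfolding pd_vf[OF w f]
    by (simp add: sum_distrib_left sum.distrib distrib_left mult_ac)
  also note sum3_rotate
  finally have vvw: "vf v (vf v (vf w f)) x = (\<Sum>p\<in>UNIV. \<Sum>q\<in>UNIV. \<Sum>r\<in>UNIV.
      v r x * pd r (v p) x * pd p (w q) x * pd q f x
      + v r x * pd r (v p) x * w q x * pd p (pd q f) x
      + v r x * v p x * pd r (pd p (w q)) x * pd q f x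
      + v r x * v p x * pd p (w q) x * pd r (pd q f) x
      + v r x * v p x * pd r (w q) x * pd p (pd q f) x
      + v r x * v p x * w q x * pd r (pd p (pd q f)) x)" .
  \<comment> \<open>The bound names are chosen so that, after the rotation, the first-order terms
    read literally as in the claim.\<close>
  have "vf w (vf v (vf v f)) x = (\<Sum>q\<in>UNIV. \<Sum>r\<in>UNIV. \<Sum>p\<in>UNIV.
      w q x * pd q (v r) x * pd r (v p) x * pd p f x
      + w q x * pd q (v r) x * v p x * pd r (pd p f) x
      + w q x * v r x * pd q (pd r (v p)) x * pd p f x
      + w q x * v r x * pd r (v p) x * pd q (pd p f) x
      + w q x * v r x * pd q (v p) x * pd r (pd p f) x
      + w q x * v r x * v p x * pd q (pd r (pd p f)) x)"
    unfolding vf_vf[OF v smooth_vf[OF v f]]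
    unfolding pd_pd_vf[OF v f]
    unfolding pd_vf[OF v f]
    by (simp add: sum_distrib_left sum.distrib distrib_left mult_ac)
  also note sum3_rotate[symmetric]
  finally have wvv: "vf w (vf v (vf v f)) x = (\<Sum>p\<in>UNIV. \<Sum>q\<in>UNIV. \<Sum>r\<in>UNIV.
      w q x * pd q (v r) x * pd r (v p) x * pd p f x
      + w q x * pd q (v r) x * v p x * pd r (pd p f) x
      + w q x * v r x * pd q (pd r (v p)) x * pd p f x
      + w q x * v r x * pd r (v p) x * pd q (pd p f) x
      + w q x * v r x * pd q (v p) x * pd r (pd p f) x
      + w q x * v r x * v p x * pd q (pd r (pd p f)) x)" .
  have swap_qr: "(\<Sum>p\<in>UNIV. \<Sum>q\<in>UNIV. \<Sum>r\<in>UNIV. F p q r) =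
      (\<Sum>p\<in>UNIV. \<Sum>q\<in>UNIV. \<Sum>r\<in>UNIV. F p r q)" for F :: "'N \<Rightarrow> 'N \<Rightarrow> 'N \<Rightarrow> real"
    by (intro sum.cong refl sum.swap)
  have rot: "(\<Sum>p\<in>UNIV. \<Sum>q\<in>UNIV. \<Sum>r\<in>UNIV. F p q r) =
      (\<Sum>p\<in>UNIV. \<Sum>q\<in>UNIV. \<Sum>r\<in>UNIV. F q r p)" for F :: "'N \<Rightarrow> 'N \<Rightarrow> 'N \<Rightarrow> real"
    by (rule sum3_rotate[symmetric])
  \<comment> \<open>Identity 1 merges the doubled pair of \<open>vvw\<close>; 2 and 3 bring the pair
    of \<open>wvv\<close> to a common form; 4 is the cancellation between the two expansions; 5
    removes the third order.\<close>
  have 1: "(\<Sum>p\<in>UNIV. \<Sum>q\<in>UNIV. \<Sum>r\<in>UNIV. v r x * v p x * pd p (w q) x * pd r (pd q f) x) =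
      (\<Sum>p\<in>UNIV. \<Sum>q\<in>UNIV. \<Sum>r\<in>UNIV. v p x * v r x * pd r (w q) x * pd p (pd q f) x)"
    by (rule trans[OF rot], rule trans[OF swap_qr]) (simp add: mult_ac)
  have 2: "(\<Sum>p\<in>UNIV. \<Sum>q\<in>UNIV. \<Sum>r\<in>UNIV. w q x * pd q (v r) x * v p x * pd r (pd p f) x) =
      (\<Sum>p\<in>UNIV. \<Sum>q\<in>UNIV. \<Sum>r\<in>UNIV. w r x * v q x * pd r (v p) x * pd p (pd q f) x)"
    by (rule trans[OF rot]) (simp add: mult_ac)
  have 3: "(\<Sum>p\<in>UNIV. \<Sum>q\<in>UNIV. \<Sum>r\<in>UNIV. w q x * v r x * pd q (v p) x * pd r (pd p f) x) =
      (\<Sum>p\<in>UNIV. \<Sum>q\<in>UNIV. \<Sum>r\<in>UNIV. w r x * v q x * pd r (v p) x * pd p (pd q f) x)"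
    by (rule trans[OF swap_qr]) (simp only: comm[OF f] mult_ac)
  have 4: "(\<Sum>p\<in>UNIV. \<Sum>q\<in>UNIV. \<Sum>r\<in>UNIV. w q x * v r x * pd r (v p) x * pd q (pd p f) x) =
      (\<Sum>p\<in>UNIV. \<Sum>q\<in>UNIV. \<Sum>r\<in>UNIV. v r x * pd r (v p) x * w q x * pd p (pd q f) x)"
    by (simp only: comm[OF f] mult_ac)
  have comm3: "pd q (pd r (pd p f)) x = pd r (pd p (pd q f)) x" for p q r
    by (simp add: pd_commute[OF f, of q p] comm[OF smooth_pd[OF f], of q r])
  have "w q x * v r x * v p x * pd q (pd r (pd p f)) x = v r x * v p x * w q x * pd r (pd p (pd q f)) x"
    for p q r using comm3[of q r p] by simp
  then have 5: "(\<Sum>p\<in>UNIV. \<Sum>q\<in>UNIV. \<Sum>r\<in>UNIV. w q x * v r x * v p x * pd q (pd r (pd p f)) x) =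
      (\<Sum>p\<in>UNIV. \<Sum>q\<in>UNIV. \<Sum>r\<in>UNIV. v r x * v p x * w q x * pd r (pd p (pd q f)) x)"
    by (simp only:)
  show ?thesis
    unfolding vvw wvv sum.distrib sum_subtractf left_diff_distrib 1 2 3 4 5 by (simp add: mult_ac)
qed

section \<open>The weighted divergence terms\<close>

text \<open>The second-order part of one weighted divergence, up to a factor 2. For
  \<open>c = z\<close> and \<open>d = a\<close> it is the pairing of the two positive terms of
  \<open>G\<close> with the Hessian; exchanging the roles gives the negative ones.\<close>

definition G_half :: "(real^'N::finite \<Rightarrow> real^'k::finite^'N) \<Rightarrow> (real^'N \<Rightarrow> real^'l::finite^'N)
    \<Rightarrow> (real^'N \<Rightarrow> real) \<Rightarrow> real^'N \<Rightarrow> real" where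
  "G_half c d f x = (\<Sum>p\<in>UNIV. \<Sum>q\<in>UNIV. \<Sum>i\<in>UNIV. \<Sum>j\<in>UNIV. \<Sum>r\<in>UNIV. \<Sum>s\<in>UNIV.
     (tr c j q x * tr c j s x * pd s (tr d i p) x * tr d i r x * pd r f x
      + tr c j q x * tr c j s x * pd s (tr d i r) x * pd r f x * tr d i p x) * pd p (pd q f) x)"

text \<open>Puts the divergence index \<open>r\<close> into the position it has in
  \<open>Rpi_half\<close>.\<close>

lemma sum6_first_to_fifth:
  "(\<Sum>r\<in>R. \<Sum>k\<in>K. \<Sum>i\<in>I. \<Sum>p\<in>P. \<Sum>q\<in>Q. \<Sum>s\<in>S. F k i p q r s) =
   (\<Sum>k\<in>K. \<Sum>i\<in>I. \<Sum>p\<in>P. \<Sum>q\<in>Q. \<Sum>r\<in>R. \<Sum>s\<in>S. F k i p q r s)"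
  by (subst sum.swap, (intro sum.cong refl, subst sum.swap)+) (intro sum.cong refl)

text \<open>Flattened to one sum over six-tuples, each identity is a bijection of index sets. The
  first two bring the terms where a derivative hits \<open>pd p f\<close> or \<open>pd s f\<close>
  to the shape of \<open>G_half\<close>; the third serves the half with exchanged roles.\<close>

lemma sum6_reindex:
  fixes F :: "'k::finite \<Rightarrow> 'i::finite \<Rightarrow> 'a::finite \<Rightarrow> 'a \<Rightarrow> 'a \<Rightarrow> 'a \<Rightarrow> real"
  shows "(\<Sum>k\<in>UNIV. \<Sum>i\<in>UNIV. \<Sum>p\<in>UNIV. \<Sum>q\<in>UNIV. \<Sum>r\<in>UNIV. \<Sum>s\<in>UNIV. F k i p q r s) =
    (\<Sum>p\<in>UNIV. \<Sum>q\<in>UNIV. \<Sum>i\<in>UNIV. \<Sum>k\<in>UNIV. \<Sum>r\<in>UNIV. \<Sum>s\<in>UNIV. F k i p s q r)"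
    and "(\<Sum>k\<in>UNIV. \<Sum>i\<in>UNIV. \<Sum>p\<in>UNIV. \<Sum>q\<in>UNIV. \<Sum>r\<in>UNIV. \<Sum>s\<in>UNIV. F k i p q r s) =
    (\<Sum>p\<in>UNIV. \<Sum>q\<in>UNIV. \<Sum>i\<in>UNIV. \<Sum>k\<in>UNIV. \<Sum>r\<in>UNIV. \<Sum>s\<in>UNIV. F k i r s q p)"
    and "(\<Sum>p\<in>UNIV. \<Sum>q\<in>UNIV. \<Sum>k\<in>UNIV. \<Sum>i\<in>UNIV. \<Sum>r\<in>UNIV. \<Sum>s\<in>UNIV. F k i p q r s) =
    (\<Sum>p\<in>UNIV. \<Sum>q\<in>UNIV. \<Sum>i\<in>UNIV. \<Sum>k\<in>UNIV. \<Sum>r\<in>UNIV. \<Sum>s\<in>UNIV. F k i q p s r)"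
  unfolding sum.cartesian_product UNIV_Times_UNIV
  by (rule sum.reindex_bij_witness[where i = "\<lambda>(p, q, i, k, r, s). (k, i, p, s, q, r)"
        and j = "\<lambda>(k, i, p, q, r, s). (p, r, i, k, s, q)"]; force)
    ((rule sum.reindex_bij_witness[where i = "\<lambda>(p, q, i, k, r, s). (k, i, r, s, q, p)"
        and j = "\<lambda>(k, i, p, q, r, s). (s, r, i, k, p, q)"]; force),
     (rule sum.reindex_bij_witness[where i = "\<lambda>(p, q, i, k, r, s). (q, p, k, i, s, r)"
        and j = "\<lambda>(p, q, k, i, r, s). (q, p, i, k, s, r)"]; force))

text \<open>Differentiating the products in \<open>sq_mat d\<close> yields two terms that are
  transposes of each other. Both gradients are that of \<open>f\<close>, so they contribute equally;
  this is the origin of the factor 2 in \<open>Rpi_half\<close>.\<close>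

lemma Gamma1_nabla_nth:
  fixes d :: "real^'N \<Rightarrow> real^'k^'N"
  assumes "smooth d"
  shows "Gamma1_nabla d f f x $ q =
    2 * (\<Sum>i\<in>UNIV. \<Sum>p\<in>UNIV. \<Sum>s\<in>UNIV. pd q (tr d i p) x * tr d i s x * pd p f x * pd s f x)"
    (is "_ = 2 * ?S")
proof -
  have sm: "smooth (sq_mat d)"
    by (intro smooth_componentwise) (simp add: sq_mat_nth smooth_intros assms)
  \<comment> \<open>Here \<open>pd\<close> acts on a matrix-valued function; extracting a row and
    then an entry is bounded linear and so commutes with it.\<close>
  have "pd q (sq_mat d) x $ p $ s = pd q (\<lambda>y. sq_mat d y $ p $ s) x" for p s
    using pd_bounded_linear[OF bounded_linear_vec_nth smooth_nth[OF sm]]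
      pd_bounded_linear[OF bounded_linear_vec_nth sm] by metis
  also have "\<dots> p s = (\<Sum>i\<in>UNIV. pd q (tr d i p) x * tr d i s x + tr d i p x * pd q (tr d i s) x)" for p s
    using assms by (simp add: sq_mat_nth pd_sum pd_mult smooth_intros)
  finally have "Gamma1_nabla d f f x $ q = (\<Sum>p\<in>UNIV. \<Sum>s\<in>UNIV. \<Sum>i\<in>UNIV.
      pd q (tr d i p) x * tr d i s x * pd p f x * pd s f x + tr d i p x * pd q (tr d i s) x * pd p f x * pd s f x)"
    by (simp add: Gamma1_nabla_def inner_vec_def matrix_vector_mult_def grad_def sum_distrib_left
        sum_distrib_right algebra_simps)
  also have "\<dots> = (\<Sum>i\<in>UNIV. \<Sum>p\<in>UNIV. \<Sum>s\<in>UNIV.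
      pd q (tr d i p) x * tr d i s x * pd p f x * pd s f x + tr d i p x * pd q (tr d i s) x * pd p f x * pd s f x)"
    by (rule sum3_rotate[symmetric])
  also have "\<dots> = ?S + (\<Sum>i\<in>UNIV. \<Sum>p\<in>UNIV. \<Sum>s\<in>UNIV. tr d i p x * pd q (tr d i s) x * pd p f x * pd s f x)"
    by (simp only: sum.distrib)
  also have "(\<Sum>i\<in>UNIV. \<Sum>p\<in>UNIV. \<Sum>s\<in>UNIV. tr d i p x * pd q (tr d i s) x * pd p f x * pd s f x) = ?S"
    by (rule sum.cong[OF refl], subst sum.swap) (simp add: mult_ac)
  finally show ?thesis by simp
qed

text \<open>For a field W, (1/\<pi>) div(\<pi> W) = div W + <grad log \<pi>, W>. The logarithmic
  term and the derivatives of the coefficients in W give \<open>Rpi_half\<close>; derivatives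
  falling on the two gradient factors of \<open>f\<close> give \<open>2 * G_half\<close>.\<close>

lemma weighted_divergence:
  fixes c :: "real^'N \<Rightarrow> real^'k^'N" and d :: "real^'N \<Rightarrow> real^'l^'N"
  assumes c: "smooth c" and d: "smooth d" and f: "smooth f" and \<pi>: "smooth \<pi>" "\<pi> x > 0"
  shows "1 / \<pi> x * divergence (\<lambda>y. \<pi> y *\<^sub>R (sq_mat c y *v Gamma1_nabla d f f y)) x =
    Rpi_half c d \<pi> f x + 2 * G_half c d f x"
proof -
  have comm: "pd p (pd q f) x = pd q (pd p f) x" for p q
    by (simp add: pd_commute[OF f, of p q])
  \<comment> \<open>A monomial of half the \<open>r\<close>-th component of the field: four
    coefficient factors and two derivatives of \<open>f\<close>.\<close>
  define T where "T k i p q r s y = tr c k r y * tr c k q y * pd q (tr d i p) y * tr d i s y * pd p f y * pd s f y"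
    for k i p q r s y
  have sT: "smooth (T k i p q r s)" for k i p q r s
    unfolding T_def[abs_def] by (intro smooth_intros c d f)
  have nth: "(sq_mat c y *v Gamma1_nabla d f f y) $ r =
      2 * (\<Sum>k\<in>UNIV. \<Sum>i\<in>UNIV. \<Sum>p\<in>UNIV. \<Sum>q\<in>UNIV. \<Sum>s\<in>UNIV. T k i p q r s y)" for y r
  proof -
    have "(sq_mat c y *v Gamma1_nabla d f f y) $ r =
        2 * (\<Sum>k\<in>UNIV. \<Sum>q\<in>UNIV. \<Sum>i\<in>UNIV. \<Sum>p\<in>UNIV. \<Sum>s\<in>UNIV. T k i p q r s y)"
      by (simp add: sq_mat_mult_nth Gamma1_nabla_nth[OF d] T_def sum_distrib_left mult_ac)
    also have "\<dots> = 2 * (\<Sum>k\<in>UNIV. \<Sum>i\<in>UNIV. \<Sum>p\<in>UNIV. \<Sum>q\<in>UNIV. \<Sum>s\<in>UNIV. T k i p q r s y)"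
      by (intro arg_cong[where f = "(*) 2"] sum.cong refl sum3_rotate)
    finally show ?thesis .
  qed
  define S where "S r y = (\<Sum>k\<in>UNIV. \<Sum>i\<in>UNIV. \<Sum>p\<in>UNIV. \<Sum>q\<in>UNIV. \<Sum>s\<in>UNIV. T k i p q r s y)" for r y
  have sS: "smooth (S r)" for r
    unfolding S_def[abs_def] by (intro smooth_intros sT)
  have pdS: "pd r (S r) x = (\<Sum>k\<in>UNIV. \<Sum>i\<in>UNIV. \<Sum>p\<in>UNIV. \<Sum>q\<in>UNIV. \<Sum>s\<in>UNIV. pd r (T k i p q r s) x)" for r
    unfolding S_def[abs_def] by (simp add: pd_sum smooth_sum sT)
  have pdT: "pd r (T k i p q r s) x =
       (pd r (tr c k r) x * tr c k q x * pd q (tr d i p) x * tr d i s x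
        + tr c k r x * pd r (tr c k q) x * pd q (tr d i p) x * tr d i s x
        + tr c k r x * tr c k q x * pd r (pd q (tr d i p)) x * tr d i s x
        + tr c k r x * tr c k q x * pd q (tr d i p) x * pd r (tr d i s) x) * pd p f x * pd s f x
       + tr c k r x * tr c k q x * pd q (tr d i p) x * tr d i s x * pd s f x * pd r (pd p f) x
       + tr c k r x * tr c k q x * pd q (tr d i p) x * tr d i s x * pd p f x * pd r (pd s f) x"
    for k i p q r s
    unfolding T_def[abs_def] using c d f by (simp add: pd_mult smooth_intros) (simp add: algebra_simps)
  have "divergence (\<lambda>y. \<pi> y *\<^sub>R (sq_mat c y *v Gamma1_nabla d f f y)) x =
      (\<Sum>r\<in>UNIV. pd r (\<lambda>y. \<pi> y * (2 * S r y)) x)"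
    by (simp add: divergence_def nth S_def)
  also have "\<dots> = (\<Sum>r\<in>UNIV. 2 * (pd r \<pi> x * S r x) + 2 * (\<pi> x * pd r (S r) x))"
    using \<pi>(1) sS by (simp add: pd_mult pd_const smooth_intros mult_ac)
  finally have "1 / \<pi> x * divergence (\<lambda>y. \<pi> y *\<^sub>R (sq_mat c y *v Gamma1_nabla d f f y)) x =
      2 * (\<Sum>r\<in>UNIV. pd r (\<lambda>y. ln (\<pi> y)) x * S r x) + 2 * (\<Sum>r\<in>UNIV. pd r (S r) x)"
    using \<pi> by (simp add: pd_ln sum.distrib sum_distrib_left sum_divide_distrib add_divide_distrib)
  moreover have "(\<Sum>r\<in>UNIV. pd r (\<lambda>y. ln (\<pi> y)) x * S r x) =
      (\<Sum>k\<in>UNIV. \<Sum>i\<in>UNIV. \<Sum>p\<in>UNIV. \<Sum>q\<in>UNIV. \<Sum>s\<in>UNIV.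
       hgrad c (\<lambda>y. ln (\<pi> y)) x $ k * tr c k q x * pd q (tr d i p) x * tr d i s x * pd p f x * pd s f x)"
  proof -
    have "(\<Sum>r\<in>UNIV. pd r (\<lambda>y. ln (\<pi> y)) x * S r x) =
      (\<Sum>k\<in>UNIV. \<Sum>i\<in>UNIV. \<Sum>p\<in>UNIV. \<Sum>q\<in>UNIV. \<Sum>r\<in>UNIV. \<Sum>s\<in>UNIV. pd r (\<lambda>y. ln (\<pi> y)) x * T k i p q r s x)"
      unfolding S_def sum_distrib_left by (rule sum6_first_to_fifth)
    \<comment> \<open>Once innermost, \<open>r\<close> contracts \<open>tr c k r\<close> with the
      gradient of log \<pi> into the \<open>hgrad\<close> factor.\<close>
    also have "\<dots> = (\<Sum>k\<in>UNIV. \<Sum>i\<in>UNIV. \<Sum>p\<in>UNIV. \<Sum>q\<in>UNIV. \<Sum>s\<in>UNIV. \<Sum>r\<in>UNIV. pd r (\<lambda>y. ln (\<pi> y)) x * T k i p q r s x)"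
      by (intro sum.cong refl sum.swap)
    finally show ?thesis
      by (simp add: hgrad_nth vf_def T_def sum_distrib_left sum_distrib_right mult_ac)
  qed
  moreover have "(\<Sum>r\<in>UNIV. pd r (S r) x) =
      (\<Sum>k\<in>UNIV. \<Sum>i\<in>UNIV. \<Sum>p\<in>UNIV. \<Sum>q\<in>UNIV. \<Sum>r\<in>UNIV. \<Sum>s\<in>UNIV.
       (pd r (tr c k r) x * tr c k q x * pd q (tr d i p) x * tr d i s x
        + tr c k r x * pd r (tr c k q) x * pd q (tr d i p) x * tr d i s x
        + tr c k r x * tr c k q x * pd r (pd q (tr d i p)) x * tr d i s x
        + tr c k r x * tr c k q x * pd q (tr d i p) x * pd r (tr d i s) x) * pd p f x * pd s f x)
      + G_half c d f x"
  proof -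
    \<comment> \<open>The derivative falls on \<open>pd p f\<close> here and on
      \<open>pd s f\<close> in the next identity; symmetry of the Hessian gives both the order used
      in \<open>G_half\<close>.\<close>
    have 1: "(\<Sum>k\<in>UNIV. \<Sum>i\<in>UNIV. \<Sum>p\<in>UNIV. \<Sum>q\<in>UNIV. \<Sum>r\<in>UNIV. \<Sum>s\<in>UNIV.
        tr c k r x * tr c k q x * pd q (tr d i p) x * tr d i s x * pd s f x * pd r (pd p f) x) =
      (\<Sum>p\<in>UNIV. \<Sum>q\<in>UNIV. \<Sum>i\<in>UNIV. \<Sum>j\<in>UNIV. \<Sum>r\<in>UNIV. \<Sum>s\<in>UNIV.
        tr c j q x * tr c j s x * pd s (tr d i p) x * tr d i r x * pd r f x * pd p (pd q f) x)"
      by (subst sum6_reindex(1)) (intro sum.cong refl, subst comm, simp)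
    have 2: "(\<Sum>k\<in>UNIV. \<Sum>i\<in>UNIV. \<Sum>p\<in>UNIV. \<Sum>q\<in>UNIV. \<Sum>r\<in>UNIV. \<Sum>s\<in>UNIV.
        tr c k r x * tr c k q x * pd q (tr d i p) x * tr d i s x * pd p f x * pd r (pd s f) x) =
      (\<Sum>p\<in>UNIV. \<Sum>q\<in>UNIV. \<Sum>i\<in>UNIV. \<Sum>j\<in>UNIV. \<Sum>r\<in>UNIV. \<Sum>s\<in>UNIV.
        tr c j q x * tr c j s x * pd s (tr d i r) x * pd r f x * tr d i p x * pd p (pd q f) x)"
      by (subst sum6_reindex(2)) (intro sum.cong refl, subst comm, simp add: mult_ac)
    show ?thesis
      unfolding pdS sum6_first_to_fifth[where K = "UNIV :: 'k set" and I = "UNIV :: 'l set"] pdT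
      by (simp only: sum.distrib 1 2 G_half_def distrib_right add.assoc)
  qed
  ultimately show ?thesis
    by (simp add: Rpi_half_def)
qed

section \<open>The Bochner identities\<close>

lemma sum_UNIV_prod: "(\<Sum>z\<in>UNIV. g z) = (\<Sum>p\<in>UNIV. \<Sum>q\<in>UNIV. g (p, q))"
  by (simp add: sum.cartesian_product UNIV_Times_UNIV[symmetric] del: UNIV_Times_UNIV)

lemma sum_swap_pairs:
  "(\<Sum>p\<in>P. \<Sum>q\<in>Q. \<Sum>i\<in>I. \<Sum>k\<in>K. g p q i k) = (\<Sum>i\<in>I. \<Sum>k\<in>K. \<Sum>p\<in>P. \<Sum>q\<in>Q. g p q i k)"
  by (simp only: sum3_rotate[where C = K])

lemma vf_vf_tr_eq:
  assumes "smooth c" "smooth f"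
  shows "vf (tr a i) (vf (tr c k) f) x = (QP a c x *v X f x + DE a c f x) $ (i, k)"
  using assms by (simp add: vf_vf smooth_intros matrix_vector_mult_def QP_def X_def DE_def
      sum_UNIV_prod sum.distrib)

text \<open>Serves for \<open>Gamma2\<close> with \<open>c = a\<close> and for the unweighted part
  of \<open>Gamma2_z_pi\<close> with \<open>c = z\<close>. In \<open>bochner\<close> the doubled
  second-order terms of the commutators become the \<open>CF\<close> term, and their first-order
  remainder \<open>R0\<close> joins the drift commutator to form \<open>Rb\<close>.\<close>

lemma Gamma2_eq:
  fixes a :: "real^'N \<Rightarrow> real^'n^'N" and c :: "real^'N \<Rightarrow> real^'k^'N"
  assumes a: "smooth a" and b: "smooth b" and c: "smooth c" and f: "smooth f"
  shows "1/2 * (L a b (Gamma1 c f f) x - Gamma1 c (L a b f) f x - Gamma1 c f (L a b f) x) =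
    (QP a c x *v X f x + DE a c f x) \<bullet> (QP a c x *v X f x + DE a c f x)
    + 2 * (CF a c f x \<bullet> X f x) + Rb a c b f x"
proof -
  let ?u = "\<lambda>k. vf (tr c k) f x"
  have sa: "smooth (tr a i p)" and sb: "smooth (\<lambda>y. b y $ p)" and sc: "smooth (tr c k p)" for i k p
    using a b c by (simp_all add: smooth_intros)
  have sq: "(\<Sum>i\<in>UNIV. \<Sum>k\<in>UNIV. (vf (tr a i) (vf (tr c k) f) x)\<^sup>2) =
      (QP a c x *v X f x + DE a c f x) \<bullet> (QP a c x *v X f x + DE a c f x)"
    by (simp add: vf_vf_tr_eq[OF c f] inner_vec_def sum_UNIV_prod power2_eq_square)
  \<comment> \<open>With \<open>?u k\<close> outside the sums over \<open>p\<close>,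
    \<open>q\<close>, \<open>r\<close>, this matches the first sum of
    \<open>vf_square_commutator\<close> term by term.\<close>
  have "CF a c f x \<bullet> X f x = (\<Sum>p\<in>UNIV. \<Sum>q\<in>UNIV. \<Sum>i\<in>UNIV. \<Sum>k\<in>UNIV. ?u k * (\<Sum>r\<in>UNIV.
      (tr a i p x * tr a i r x * pd r (tr c k q) x - tr c k r x * tr a i q x * pd r (tr a i p) x)
        * pd p (pd q f) x))"
    by (simp add: inner_vec_def sum_UNIV_prod CF_def X_def hgrad_nth sum_distrib_left sum_distrib_right mult_ac)
  also have "\<dots> = (\<Sum>i\<in>UNIV. \<Sum>k\<in>UNIV. ?u k * (\<Sum>p\<in>UNIV. \<Sum>q\<in>UNIV. \<Sum>r\<in>UNIV.
      (tr a i p x * tr a i r x * pd r (tr c k q) x - tr c k r x * tr a i q x * pd r (tr a i p) x)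
        * pd p (pd q f) x))"
    by (subst sum_swap_pairs) (simp only: sum_distrib_left)
  finally have CF: "CF a c f x \<bullet> X f x = \<dots>" .
  have R0: "R0 a c f x = (\<Sum>i\<in>UNIV. \<Sum>k\<in>UNIV. ?u k * (\<Sum>p\<in>UNIV. \<Sum>q\<in>UNIV. \<Sum>r\<in>UNIV.
      tr a i r x * pd r (tr a i p) x * pd p (tr c k q) x * pd q f x
      + tr a i r x * tr a i p x * pd r (pd p (tr c k q)) x * pd q f x
      - tr c k q x * pd q (tr a i r) x * pd r (tr a i p) x * pd p f x
      - tr c k q x * tr a i r x * pd q (pd r (tr a i p)) x * pd p f x))"
    by (simp only: R0_def hgrad_nth sum_distrib_left mult.commute[of _ "?u _"])
  have "(\<Sum>k\<in>UNIV. ?u k * (\<Sum>i\<in>UNIV. vf (tr a i) (vf (tr a i) (vf (tr c k) f)) x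
      - vf (tr c k) (vf (tr a i) (vf (tr a i) f)) x)) =
    (\<Sum>i\<in>UNIV. \<Sum>k\<in>UNIV. ?u k * (vf (tr a i) (vf (tr a i) (vf (tr c k) f)) x
      - vf (tr c k) (vf (tr a i) (vf (tr a i) f)) x))"
    by (subst sum.swap) (simp only: sum_distrib_left)
  also have "\<dots> = 2 * (CF a c f x \<bullet> X f x) + R0 a c f x"
    unfolding vf_square_commutator[OF sa sc f] CF R0
    by (simp only: distrib_left sum.distrib mult.left_commute[of _ 2] sum_distrib_left[of 2, symmetric])
  finally have quad: "(\<Sum>k\<in>UNIV. ?u k * (\<Sum>i\<in>UNIV. vf (tr a i) (vf (tr a i) (vf (tr c k) f)) x
      - vf (tr c k) (vf (tr a i) (vf (tr a i) f)) x)) = \<dots>" .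
  have drift: "(\<Sum>k\<in>UNIV. ?u k * (vf (\<lambda>p y. b y $ p) (vf (tr c k) f) x
      - vf (tr c k) (vf (\<lambda>p y. b y $ p) f) x)) = Rb a c b f x - R0 a c f x"
    unfolding vf_commutator[OF sb sc f]
    by (simp add: Rb_def hgrad_nth sum_distrib_left sum_negf mult.commute)
  show ?thesis
    unfolding bochner[OF a b c f] sq quad drift by simp
qed

text \<open>\<open>G_half z a\<close> is literally the positive pair of terms. For the negative pair
  \<open>p\<close> is exchanged with \<open>q\<close> and \<open>r\<close> with \<open>s\<close>,
  which the symmetry of the Hessian permits.\<close>

lemma G_inner_X:
  assumes "smooth f"
  shows "G a z f x \<bullet> X f x = G_half z a f x - G_half a z f x"
proof -
  have "G_half a z f x = (\<Sum>p\<in>UNIV. \<Sum>q\<in>UNIV. \<Sum>i\<in>UNIV. \<Sum>j\<in>UNIV. \<Sum>r\<in>UNIV. \<Sum>s\<in>UNIV.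
     (tr a i p x * tr a i r x * pd r (tr z j q) x * tr z j s x * pd s f x
      + tr a i p x * tr a i r x * pd r (tr z j s) x * pd s f x * tr z j q x) * pd p (pd q f) x)"
    unfolding G_half_def by (subst sum6_reindex(3)) (simp only: pd_commute[OF assms] mult_ac)
  then show ?thesis
    by (simp add: G_half_def G_def X_def inner_vec_def sum_UNIV_prod sum_distrib_right
        sum_subtractf[symmetric] left_diff_distrib diff_diff_eq[symmetric] distrib_right)
qed

section \<open>Gram forms and completion of the squares\<close>

lemma inner_transpose_mult:
  fixes A :: "real^'n^'m"
  shows "(transpose A *v u) \<bullet> w = u \<bullet> (A *v w)"
  by (metis dot_lmul_matrix transpose_matrix_vector)

text \<open>Turns each Gram form into an inner product of images, so that only images under
  \<open>?Q\<close> and \<open>?P\<close> have to be compared in the end.\<close>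

lemma inner_gram_mult:
  fixes A :: "real^'n^'m"
  shows "u \<bullet> ((transpose A ** A) *v w) = (A *v u) \<bullet> (A *v w)"
  by (metis inner_commute inner_transpose_mult matrix_vector_mul_assoc)

theorem theorem1:
  fixes a :: "real^'N \<Rightarrow> real^'n^'N"
    and z :: "real^'N \<Rightarrow> real^'m^'N"
    and b :: "real^'N \<Rightarrow> real^'N"
    and \<pi> f :: "real^'N \<Rightarrow> real"
    and x :: "real^'N"
    and \<Lambda>1 \<Lambda>2 :: "real^('N \<times> 'N)"
  assumes "CARD('N) = CARD('n) + CARD('m)"
    and "smooth a" and "smooth z" and "smooth b"
    and "smooth \<pi>" and "\<And>y. \<pi> y > 0" and "probability_density \<pi>"
    and "b = (\<lambda>y. otimes_nabla a y + sq_mat a y *v grad (\<lambda>w. ln (\<pi> w)) y)"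
    and "bracket_generating a"
    and "smooth f"
    and "((transpose (QP a a x) ** QP a a x) *v \<Lambda>1
          + (transpose (QP a z x) ** QP a z x) *v \<Lambda>2) \<bullet> X f x
       = (CF a z f x + CF a a f x + G a z f x
          + transpose (QP a a x) *v DE a a f x
          + transpose (QP a z x) *v DE a z f x) \<bullet> X f x"
  shows "Gamma2 a b f f x + Gamma2_z_pi a z b \<pi> f f x
       = Hess_norm_sq a z f \<Lambda>1 \<Lambda>2 x + R_form a z b \<pi> f \<Lambda>1 \<Lambda>2 x"
proof -
  let ?Q = "QP a a x" and ?P = "QP a z x" and ?X = "X f x"
  \<comment> \<open>The hypothesis with all transposes moved across and \<open>G\<close> split into
    halves; its left side is half the mixed term of the completed squares.\<close>
  have "(?Q *v ?X) \<bullet> (?Q *v \<Lambda>1) + (?P *v ?X) \<bullet> (?P *v \<Lambda>2) =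
      CF a z f x \<bullet> ?X + CF a a f x \<bullet> ?X + (G_half z a f x - G_half a z f x)
      + DE a a f x \<bullet> (?Q *v ?X) + DE a z f x \<bullet> (?P *v ?X)"
    using assms(11) by (simp add: inner_left_distrib inner_transpose_mult G_inner_X[OF assms(10)]
        inner_commute[of "(_ ** _) *v _"] inner_gram_mult dot_lmul_matrix)
  moreover have "Gamma2 a b f f x = (?Q *v ?X + DE a a f x) \<bullet> (?Q *v ?X + DE a a f x)
      + 2 * (CF a a f x \<bullet> ?X) + Rb a a b f x"
    unfolding Gamma2_def using Gamma2_eq[OF assms(2,4,2,10)] .
  \<comment> \<open>Both divergences come from one lemma with \<open>a\<close> and \<open>z\<close>
    exchanged; their difference is \<open>Rpi\<close> plus twice the pairing of \<open>G\<close>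
    with the Hessian.\<close>
  moreover have "Gamma2_z_pi a z b \<pi> f f x = (?P *v ?X + DE a z f x) \<bullet> (?P *v ?X + DE a z f x)
      + 2 * (CF a z f x \<bullet> ?X) + Rb a z b f x
      + (Rpi_half z a \<pi> f x + 2 * G_half z a f x) - (Rpi_half a z \<pi> f x + 2 * G_half a z f x)"
    unfolding Gamma2_z_pi_def Gamma2_eq[OF assms(2,4,3,10)]
      weighted_divergence[OF assms(2,3,10,5,6)] weighted_divergence[OF assms(3,2,10,5,6)] by simp
  \<comment> \<open>On the right, |Q(X + \<Lambda>1)|^2 - |Q \<Lambda>1|^2 = |QX|^2 + 2 <QX, Q
    \<Lambda>1>, and likewise for P. On the left, |QX + D|^2 and |PX + E|^2 are expanded. The mixed
    terms then differ by twice the first identity.\<close>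
  ultimately show ?thesis
    unfolding Hess_norm_sq_def R_form_def Rpi_def inner_gram_mult
    by (simp add: matrix_vector_right_distrib inner_add inner_commute algebra_simps)
qed

end
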